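(* Let $\mathfrak a=\dfrac{h(\mathfrak a)(t)}{(1-t)^{d_{\mathfrak a}}}$ and $\mathfrak b=\dfrac{h(\mathfrak b)(t)}{(1-t)^{d_{\mathfrak b}}}$ be nonzero formal Laurent series satisfying property ( * ), with $h(\mathfrak a)(t),h(\mathfrak b)(t)\in\mathbb C[t,t^{-1}]$, $b_{\mathfrak a}=d_{\mathfrak a}-1\ge0$ and $b_{\mathfrak b}=d_{\mathfrak b}-1\ge0$. For any nonzero Laurent series $\mathfrak c$ satisfying ( * ), let $\sigma_{\mathfrak c}=\min\{n: h_n(\mathfrak c)\ne0\}$ and $r_{\mathfrak c}=\deg h(\mathfrak c)(t)$. Then: (1) $r_{\mathfrak a\underline{\otimes}\mathfrak b}\le\max(b_{\mathfrak a}+r_{\mathfrak b},\,b_{\mathfrak b}+r_{\mathfrak a})$. (2) If for all $\sigma_{\mathfrak a}\le i\le r_{\mathfrak a}$ and $\sigma_{\mathfrak b}\le j\le r_{\mathfrak b}$ such that $h_i(\mathfrak a)\ne0$ and $h_j(\mathfrak b)\ne0$ we have $b_{\mathfrak b}+i-j\ge0$ and $b_{\mathfrak a}+j-i\ge0$, then $$r_{\mathfrak a\underline{\otimes}\mathfrak b}\le\min(b_{\mathfrak a}+r_{\mathfrak b},\,b_{\mathfrak b}+r_{\mathfrak a}).$$ Moreover, if in addition $h_i(\mathfrak a)\ge0$ and $h_j(\mathfrak b)\ge0$ (real and nonnegative) for all $i,j$, then $r_{\mathfrak a\underline{\otimes}\mathfrak b}=\min(b_{\mathfrak a}+r_{\mathfrak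 b},\,b_{\mathfrak b}+r_{\mathfrak a})$. (3) If $0\le\sigma_{\mathfrak a}\le r_{\mathfrak a}\le b_{\mathfrak a}$ and $0\le\sigma_{\mathfrak b}\le r_{\mathfrak b}\le b_{\mathfrak b}$, then $$r_{\mathfrak a\underline{\otimes}\mathfrak b}\le\min(b_{\mathfrak a}+r_{\mathfrak b},\,b_{\mathfrak b}+r_{\mathfrak a}).$$ Moreover, if in addition $h_i(\mathfrak a)\ge0$ and $h_j(\mathfrak b)\ge0$ for all $i,j$, then $r_{\mathfrak a\underline{\otimes}\mathfrak b}=\min(b_{\mathfrak a}+r_{\mathfrak b},\,b_{\mathfrak b}+r_{\mathfrak a})$.
   Context: A formal Laurent series $\mathfrak a=\sum_{l\ge\sigma_{\mathfrak a}}a_lt^l$ ($\sigma_{\mathfrak a}\in\mathbb Z$, $a_l\in\mathbb C$) satisfies property ( * ) if $\mathfrak a=\dfrac{h(\mathfrak a)(t)}{(1-t)^{d_{\mathfrak a}}}$ for some integer $d_{\mathfrak a}\ge 0$ and some $h(\mathfrak a)(t)\in\mathbb C[t,t^{-1}]$. Equivalently, there is a polynomial $\Phi_{\mathfrak a}$ with $a_l=\Phi_{\mathfrak a}(l)$ for $l\gg0$; one takes $d_{\mathfrak a}=\deg\Phi_{\mathfrak a}+1$ if $\Phi_{\mathfrak a}\ne0$ and $d_{\mathfrak a}=0$ if $\Phi_{\mathfrak a}=0$ (so $h(\mathfrak a)(1)\ne0$ when $d_{\mathfrak a}>0$). Write $h(\mathfrak a)(t)=\sum_n h_n(\mathfrak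 a)t^n$; $\deg h(\mathfrak a)(t)$ is the largest $n$ with $h_n(\mathfrak a)\neq0$. The Segre transform of $\mathfrak a=\sum a_lt^l$ and $\mathfrak b=\sum b_lt^l$ is $\mathfrak a\,\underline{\otimes}\,\mathfrak b=\sum_{l}a_lb_lt^l$. It again satisfies ( * ), with $d_{\mathfrak a\underline{\otimes}\mathfrak b}=d_{\mathfrak a}+d_{\mathfrak b}-1$ when $d_{\mathfrak a},d_{\mathfrak b}\ge1$, so $h(\mathfrak a\underline{\otimes}\mathfrak b)(t)=(1-t)^{b_{\mathfrak a}+b_{\mathfrak b}+1}(\mathfrak a\underline{\otimes}\mathfrak b)$. *)

theory Defs
  imports
    "HOL-Computational_Algebra.Formal_Laurent_Series"
    "HOL-Computational_Algebra.Polynomial"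
    "HOL-Library.Nonpos_Ints"
begin

unbundle fps_syntax

(* The Laurent polynomial ring C[t, t^{-1}] inside the field of formal Laurent series. *)
definition laurent_polynomial :: "complex fls \<Rightarrow> bool" where
  "laurent_polynomial f \<longleftrightarrow> finite {n. f $$ n \<noteq> 0}"

(* Property ( * ): the quotient is taken in the field of formal Laurent series,
   i.e. 1 / (1 - t)^d is expanded at t = 0. *)
definition property_star :: "complex fls \<Rightarrow> bool" where
  "property_star a \<longleftrightarrow>
     (\<exists>(d::nat) h. laurent_polynomial h \<and> a = h / (1 - fls_X) ^ d)"

(* Meaningful only under property_star; see Phi_poly_eventually and Phi_poly_eqI below. *)
definition Phi_poly :: "complex fls \<Rightarrow> complex poly" where
  "Phi_poly a = (THE p. \<forall>\<^sub>F l in at_top. a $$ l = poly p (of_int l))"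

definition d_exp :: "complex fls \<Rightarrow> nat" where
  "d_exp a = (if Phi_poly a = 0 then 0 else degree (Phi_poly a) + 1)"

definition h_num :: "complex fls \<Rightarrow> complex fls" where
  "h_num a = (1 - fls_X) ^ d_exp a * a"

(* Integer valued, so that b_a = -1 when d_a = 0. *)
definition b_num :: "complex fls \<Rightarrow> int" where
  "b_num a = int (d_exp a) - 1"

(* Min and Max are taken over a finite nonempty set when a is nonzero and satisfies ( * );
   see laurent_polynomial_h_num and h_num_eq_0_iff. *)
definition sigma_num :: "complex fls \<Rightarrow> int" where
  "sigma_num a = Min {n. h_num a $$ n \<noteq> 0}"

definition r_num :: "complex fls \<Rightarrow> int" where
  "r_num a = Max {n. h_num a $$ n \<noteq> 0}"

definition segre :: "complex fls \<Rightarrow> complex fls \<Rightarrow> complex fls" where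
  "segre a b = Abs_fls (\<lambda>l. a $$ l * b $$ l)"

lemma segre_nth [simp]: "segre a b $$ l = a $$ l * b $$ l"
proof -
  have "\<forall>\<^sub>\<infinity>n. a $$ (- int n) * b $$ (- int n) = 0"
    using MOST_fls_neg_nth_eq_0[of a] by (rule MOST_mono) simp
  then show ?thesis
    unfolding segre_def by (rule nth_Abs_fls)
qed

lemma one_minus_fls_X_times_nth: "((1 - fls_X) * a) $$ l = a $$ l - a $$ (l - 1)"
  for a :: "complex fls"
  by (simp add: algebra_simps fls_X_times_conv_shift)

lemma eventually_at_top_int_minus1:
  assumes "\<forall>\<^sub>F l in at_top. P (l::int)"
  shows "\<forall>\<^sub>F l in at_top. P (l - 1)"
proof -
  obtain N where "\<And>l. l \<ge> N \<Longrightarrow> P l"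
    using assms unfolding eventually_at_top_linorder by auto
  then show ?thesis
    unfolding eventually_at_top_linorder by (intro exI[of _ "N + 1"]) auto
qed

lemma poly_eq_if_eventually_eq:
  fixes p q :: "complex poly"
  assumes "\<forall>\<^sub>F l in at_top. poly p (of_int l) = poly q (of_int l)"
  shows "p = q"
proof (rule ccontr)
  assume "p \<noteq> q"
  then have fin: "finite {x. poly (p - q) x = 0}"
    by (intro poly_roots_finite) auto
  obtain N where N: "\<And>l. l \<ge> N \<Longrightarrow> poly p (of_int l) = poly q (of_int l)"
    using assms unfolding eventually_at_top_linorder by auto
  have "of_int ` {N..} \<subseteq> {x. poly (p - q) x = 0}"
    using N by auto
  then have "finite (of_int ` {N..} :: complex set)"
    using fin finite_subset by blast
  then have "finite {N..}"
    by (rule finite_imageD) (auto simp: inj_on_def)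
  then show False
    by (simp add: infinite_Ici)
qed

lemma Phi_poly_eqI:
  assumes "\<forall>\<^sub>F l in at_top. a $$ l = poly p (of_int l)"
  shows "Phi_poly a = p"
  unfolding Phi_poly_def
proof (rule the_equality)
  fix q assume "\<forall>\<^sub>F l in at_top. a $$ l = poly q (of_int l)"
  with assms have "\<forall>\<^sub>F l in at_top. poly q (of_int l) = poly p (of_int l)"
    by eventually_elim simp
  then show "q = p" by (rule poly_eq_if_eventually_eq)
qed (fact assms)

lemma degree_backward_difference:
  fixes p :: "complex poly"
  shows "p - pcompose p [:-1, 1:] = 0 \<or> degree (p - pcompose p [:-1, 1:]) < degree p"
proof (cases "degree p = 0")
  case True
  then obtain c where "p = [:c:]" by (metis degree_eq_zeroE)
  then show ?thesis by simp
next
  case False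
  have deg: "degree (pcompose p [:-1, 1:]) = degree p"
    by (simp add: degree_pcompose)
  have "lead_coeff (pcompose p [:-1, 1:]) = lead_coeff p"
    by (subst lead_coeff_comp) auto
  then have "coeff (p - pcompose p [:-1, 1:]) (degree p) = 0"
    using deg by simp
  moreover have "degree (p - pcompose p [:-1, 1:]) \<le> degree p"
    using deg by (metis degree_diff_le order_refl)
  ultimately show ?thesis
    by (metis leading_coeff_0_iff le_neq_implies_less)
qed

lemma ex_backward_antidifference:
  fixes p :: "complex poly"
  shows "\<exists>q. \<forall>x. poly q x - poly q (x - 1) = poly p x"
proof (induction "degree p" arbitrary: p rule: less_induct)
  case less
  show ?case
  proof (cases "p = 0")
    case True
    then show ?thesis by (intro exI[of _ 0]) simp
  next
    case False
    define n where "n = degree p"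
    define r where "r = monom (1::complex) (Suc n) - [:-1, 1:] ^ Suc n"
    have rp: "poly r x = x ^ Suc n - (x - 1) ^ Suc n" for x
      by (simp add: r_def poly_monom poly_power del: power_Suc)
    have co: "coeff ([:-1, 1:] ^ Suc n :: complex poly) i
        = of_nat (Suc n choose i) * (-1) ^ (Suc n - i)" if "i \<le> Suc n" for i
      using that by (simp add: coeff_linear_poly_power del: power_Suc)
    have rn: "coeff r n = of_nat (Suc n)"
      using co[of n] by (simp add: r_def del: power_Suc)
    have rtop: "coeff r i = 0" if "i > n" for i
    proof (cases "i = Suc n")
      case True
      then show ?thesis using co[of i] by (simp add: r_def del: power_Suc)
    next
      case False
      then have "coeff ([:-1, 1:] ^ Suc n :: complex poly) i = 0"
        using that by (intro coeff_eq_0) (simp add: degree_linear_power del: power_Suc)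
      then show ?thesis
        using False that by (simp add: r_def del: power_Suc)
    qed
    define c where "c = lead_coeff p / of_nat (Suc n)"
    define s where "s = p - smult c r"
    have cr: "c * of_nat (Suc n) = lead_coeff p"
      unfolding c_def by (simp del: of_nat_Suc)
    have sz: "coeff s i = 0" if "i \<ge> n" for i
    proof (cases "i = n")
      case True
      then show ?thesis using rn cr by (simp add: s_def n_def)
    next
      case False
      then show ?thesis
        using that rtop[of i] coeff_eq_0[of p i] by (simp add: s_def n_def)
    qed
    have "\<exists>q. \<forall>x. poly q x - poly q (x - 1) = poly s x"
    proof (cases "s = 0")
      case True
      then show ?thesis by (intro exI[of _ 0]) simp
    next
      case False
      have "degree s < degree p"
        using sz[of "degree s"] False n_def by (meson leading_coeff_0_iff not_le)
      then show ?thesis by (rule less)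
    qed
    then obtain q where q: "\<And>x. poly q x - poly q (x - 1) = poly s x" by blast
    have "poly (q + monom c (Suc n)) x - poly (q + monom c (Suc n)) (x - 1) = poly p x" for x
    proof -
      have "poly (q + monom c (Suc n)) x - poly (q + monom c (Suc n)) (x - 1)
          = (poly q x - poly q (x - 1)) + c * (x ^ Suc n - (x - 1) ^ Suc n)"
        by (simp add: poly_monom algebra_simps del: power_Suc)
      also have "\<dots> = poly p x"
        unfolding q rp[symmetric] s_def by simp
      finally show ?thesis .
    qed
    then show ?thesis by blast
  qed
qed

lemma finite_support_imp_eventually_zero:
  assumes "finite {n::int. f n \<noteq> 0}"
  shows "\<forall>\<^sub>F l in at_top. f l = 0"
proof -
  obtain N where "\<And>n. f n \<noteq> 0 \<Longrightarrow> n \<le> N"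
    using bdd_above_finite[OF assms] unfolding bdd_above_def by auto
  then show ?thesis
    unfolding eventually_at_top_linorder by (intro exI[of _ "N + 1"]) force
qed

lemma one_minus_fls_X_neq_0: "1 - fls_X \<noteq> (0 :: complex fls)"
proof
  assume "1 - fls_X = (0 :: complex fls)"
  then have "(1 - fls_X :: complex fls) $$ 0 = 0" by simp
  then show False by simp
qed

lemma eventually_poly_laurent_polynomial_div:
  assumes "laurent_polynomial h"
  shows "\<exists>p. \<forall>\<^sub>F l in at_top. (h / (1 - fls_X) ^ d) $$ l = poly p (of_int l)"
proof (induction d)
  case 0
  show ?case
    using finite_support_imp_eventually_zero[OF assms[unfolded laurent_polynomial_def]]
    by (intro exI[of _ 0]) simp
next
  case (Suc d)
  then obtain p where p: "\<forall>\<^sub>F l in at_top. (h / (1 - fls_X) ^ d) $$ l = poly p (of_int l)"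
    by blast
  obtain q where q: "\<And>x. poly q x - poly q (x - 1) = poly p x"
    using ex_backward_antidifference by blast
  define c where "c = h / (1 - fls_X) ^ Suc d"
  have "(1 - fls_X) * c = h / (1 - fls_X) ^ d"
    unfolding c_def using one_minus_fls_X_neq_0 by (simp add: field_simps)
  then have diff: "(h / (1 - fls_X) ^ d) $$ l = c $$ l - c $$ (l - 1)" for l
    using one_minus_fls_X_times_nth[of c l] by simp
  obtain N where N: "\<And>l. l \<ge> N \<Longrightarrow> (h / (1 - fls_X) ^ d) $$ l = poly p (of_int l)"
    using p unfolding eventually_at_top_linorder by auto
  define k where "k = c $$ N - poly q (of_int N)"
  have "c $$ l = poly (q + [:k:]) (of_int l)" if "l \<ge> N" for l
    using that
  proof (induction l rule: int_ge_induct)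
    case base
    then show ?case by (simp add: k_def)
  next
    case (step l)
    then show ?case
      using N[of "l + 1"] diff[of "l + 1"] q[of "of_int (l + 1)"] by (simp add: algebra_simps)
  qed
  then show ?case
    unfolding c_def eventually_at_top_linorder by blast
qed

lemma Phi_poly_eventually:
  assumes "property_star a"
  shows "\<forall>\<^sub>F l in at_top. a $$ l = poly (Phi_poly a) (of_int l)"
proof -
  obtain p where "\<forall>\<^sub>F l in at_top. a $$ l = poly p (of_int l)"
    using assms eventually_poly_laurent_polynomial_div unfolding property_star_def by blast
  then show ?thesis
    using Phi_poly_eqI by blast
qed

lemma laurent_polynomial_if_eventually_zero:
  assumes "\<forall>\<^sub>F l in at_top. a $$ l = 0"
  shows "laurent_polynomial a"
proof -
  obtain N where N: "\<And>l. l \<ge> N \<Longrightarrow> a $$ l = 0"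
    using assms unfolding eventually_at_top_linorder by auto
  have "{n. a $$ n \<noteq> 0} \<subseteq> {fls_subdegree a..N}"
  proof
    fix n assume "n \<in> {n. a $$ n \<noteq> 0}"
    then have "a $$ n \<noteq> 0" by simp
    then show "n \<in> {fls_subdegree a..N}"
      using N[of n] fls_subdegree_leI[of a n] by (cases "n \<le> N") auto
  qed
  then show ?thesis
    unfolding laurent_polynomial_def using finite_subset by blast
qed

lemma laurent_polynomial_power_times:
  assumes "\<forall>\<^sub>F l in at_top. a $$ l = poly p (of_int l)" and "p = 0 \<or> degree p < n"
  shows "laurent_polynomial ((1 - fls_X) ^ n * a)"
  using assms
proof (induction n arbitrary: a p)
  case 0
  then show ?case by (intro laurent_polynomial_if_eventually_zero) simp
next
  case (Suc n)
  define q where "q = p - pcompose p [:-1, 1:]"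
  have "\<forall>\<^sub>F l in at_top. ((1 - fls_X) * a) $$ l = poly q (of_int l)"
    using Suc.prems(1) eventually_at_top_int_minus1[OF Suc.prems(1)]
    by eventually_elim (simp add: one_minus_fls_X_times_nth q_def poly_pcompose)
  moreover have "q = 0 \<or> degree q < n"
    using Suc.prems(2) degree_backward_difference[of p] unfolding q_def by auto
  ultimately have "laurent_polynomial ((1 - fls_X) ^ n * ((1 - fls_X) * a))"
    by (rule Suc.IH)
  then show ?case by (simp add: mult_ac)
qed

lemma laurent_polynomial_h_num:
  assumes "property_star a"
  shows "laurent_polynomial (h_num a)"
  unfolding h_num_def
  using Phi_poly_eventually[OF assms]
  by (rule laurent_polynomial_power_times) (simp add: d_exp_def)

lemma h_num_eq_0_iff: "h_num a = 0 \<longleftrightarrow> a = 0"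
  using one_minus_fls_X_neq_0 by (simp add: h_num_def)

lemma eq_h_num_divide: "a = h_num a / (1 - fls_X) ^ d_exp a"
  using one_minus_fls_X_neq_0 by (simp add: h_num_def)

lemma property_star_iff:
  "property_star a \<longleftrightarrow> (\<exists>p. \<forall>\<^sub>F l in at_top. a $$ l = poly p (of_int l))"
proof
  assume "\<exists>p. \<forall>\<^sub>F l in at_top. a $$ l = poly p (of_int l)"
  then obtain p where p: "\<forall>\<^sub>F l in at_top. a $$ l = poly p (of_int l)" by blast
  have "laurent_polynomial ((1 - fls_X) ^ Suc (degree p) * a)"
    using p by (rule laurent_polynomial_power_times) simp
  moreover have "a = ((1 - fls_X) ^ Suc (degree p) * a) / (1 - fls_X) ^ Suc (degree p)"
    using one_minus_fls_X_neq_0 by simp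
  ultimately show "property_star a"
    unfolding property_star_def by blast
qed (use Phi_poly_eventually in blast)

lemma property_star_segre:
  assumes "property_star a" and "property_star b"
  shows "property_star (segre a b)"
proof -
  have "\<forall>\<^sub>F l in at_top. segre a b $$ l = poly (Phi_poly a * Phi_poly b) (of_int l)"
    using Phi_poly_eventually[OF assms(1)] Phi_poly_eventually[OF assms(2)]
    by eventually_elim simp
  then show ?thesis unfolding property_star_iff by blast
qed

lemma b_num_segre:
  assumes "property_star a" and "property_star b" and "b_num a \<ge> 0" and "b_num b \<ge> 0"
  shows "b_num (segre a b) = b_num a + b_num b"
proof -
  have "\<forall>\<^sub>F l in at_top. segre a b $$ l = poly (Phi_poly a * Phi_poly b) (of_int l)"
    using Phi_poly_eventually[OF assms(1)] Phi_poly_eventually[OF assms(2)]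
    by eventually_elim simp
  then have "Phi_poly (segre a b) = Phi_poly a * Phi_poly b"
    by (rule Phi_poly_eqI)
  moreover have "Phi_poly a \<noteq> 0" "Phi_poly b \<noteq> 0"
    using assms(3,4) by (auto simp: b_num_def d_exp_def split: if_splits)
  ultimately show ?thesis
    by (simp add: b_num_def d_exp_def degree_mult_eq)
qed

end

theory Submission
  imports Defs
begin

text \<open>Expand $a$ and $b$ in the series $t^i/(1-t)^{p+1}$ and $t^j/(1-t)^{q+1}$, where
  $p = b_a$ and $q = b_b$; the coefficients are those of $h(a)$ and $h(b)$. The coefficients of
  $t^i/(1-t)^{p+1}$ agree with the polynomial $\binom{l-i+p}{p}$ for all $l \ge i - p$, since
  its roots are $i-p, \dots, i-1$. Hence the Segre product of two such series agrees with a
  polynomial of degree $p+q$ from some index $e$ on, and multiplying by $(1-t)^{p+q+1}$ kills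
  all coefficients from $e+p+q+1$ on. One may take $e = \max(i-p,j-q)$, and even
  $e = \min(i-p,j-q)$ if the intervals of roots leave no gap. In the latter case the coefficient
  at $e+p+q$ is up to sign the value of the polynomial at $e-1$, and turns out to be positive.\<close>

section \<open>Iterated differences of eventually polynomial coefficients\<close>

text \<open>Each factor 1 - t takes a backward difference: it lowers the degree of \<open>P\<close>
  and moves the start of the agreement up by one, so \<open>n\<close> factors leave zero. One index
  earlier only the defect at \<open>e - 1\<close> is felt, with one sign change per
  difference.\<close>

lemma one_minus_fls_X_power_times_nth:
  fixes c :: "complex fls"
  assumes "\<And>l. l \<ge> e \<Longrightarrow> c $$ l = poly P (of_int l)" and "P = 0 \<or> degree P < n"
  shows "k \<ge> e + int n \<Longrightarrow> ((1 - fls_X) ^ n * c) $$ k = 0"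
    and "((1 - fls_X) ^ n * c) $$ (e + int n - 1) = (-1) ^ n * (c $$ (e - 1) - poly P (of_int (e - 1)))"
  using assms
proof (induction n arbitrary: c P e)
  case 0
  {
    case 1 then show ?case by simp
  next
    case 2 then show ?case by simp
  }
next
  case (Suc n)
  define Q where "Q P = P - pcompose P [:-1, 1:]" for P :: "complex poly"
  have diff: "((1 - fls_X) * c) $$ l = poly (Q P) (of_int l)"
    if "\<And>l. l \<ge> e \<Longrightarrow> c $$ l = poly P (of_int l)" "l \<ge> e + 1"
    for c :: "complex fls" and P e l
    using that by (simp add: one_minus_fls_X_times_nth Q_def poly_pcompose)
  have deg: "Q P = 0 \<or> degree (Q P) < n" if "P = 0 \<or> degree P < Suc n" for P
    using that degree_backward_difference[of P] unfolding Q_def by auto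
  have shift: "(1 - fls_X) ^ Suc n * c = (1 - fls_X) ^ n * ((1 - fls_X) * c)"
    for c :: "complex fls"
    by (simp add: mult_ac)
  {
    case 1
    have "((1 - fls_X) ^ n * ((1 - fls_X) * c)) $$ k = 0"
    proof (rule Suc.IH(1))
      show "((1 - fls_X) * c) $$ l = poly (Q P) (of_int l)" if "l \<ge> e + 1" for l
        using 1(2) that by (rule diff)
      show "Q P = 0 \<or> degree (Q P) < n"
        using 1(3) by (rule deg)
    qed (use 1 in simp)
    then show ?case unfolding shift .
  next
    case 2
    have "((1 - fls_X) ^ n * ((1 - fls_X) * c)) $$ (e + 1 + int n - 1)
      = (-1) ^ n * (((1 - fls_X) * c) $$ (e + 1 - 1) - poly (Q P) (of_int (e + 1 - 1)))"
    proof (rule Suc.IH(2))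
      show "((1 - fls_X) * c) $$ l = poly (Q P) (of_int l)" if "l \<ge> e + 1" for l
        using 2(1) that by (rule diff)
      show "Q P = 0 \<or> degree (Q P) < n"
        using 2(2) by (rule deg)
    qed
    \<comment> \<open>Since \<open>c\<close> and \<open>P\<close> agree at \<open>e\<close>, the
      defect of the difference there is minus the defect at \<open>e - 1\<close>.\<close>
    also have "((1 - fls_X) * c) $$ (e + 1 - 1) - poly (Q P) (of_int (e + 1 - 1))
      = - (c $$ (e - 1) - poly P (of_int (e - 1)))"
      using 2(1)[of e] by (simp add: one_minus_fls_X_times_nth Q_def poly_pcompose)
    finally show ?case unfolding shift by (simp add: algebra_simps)
  }
qed

section \<open>The series t^i/(1-t)^(p+1) and their polynomials\<close>

definition binomial_fls :: "int \<Rightarrow> nat \<Rightarrow> complex fls" where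
  "binomial_fls i p = Abs_fls (\<lambda>l. if l \<ge> i then of_nat ((nat (l - i) + p) choose p) else 0)"

lemma binomial_fls_nth:
  "binomial_fls i p $$ l = (if l \<ge> i then of_nat ((nat (l - i) + p) choose p) else 0)"
  unfolding binomial_fls_def by (rule nth_Abs_fls_lower_bound[of i]) auto

text \<open>Pascal's rule above \<open>i\<close>; at \<open>i\<close> itself both coefficients are
  1.\<close>

lemma one_minus_fls_X_times_binomial_fls:
  "(1 - fls_X) * binomial_fls i (Suc p) = binomial_fls i p"
proof (rule fls_eqI)
  fix l
  consider "l < i" | "l = i" | "l > i" by linarith
  then show "((1 - fls_X) * binomial_fls i (Suc p)) $$ l = binomial_fls i p $$ l"
  proof cases
    case 3
    define n where "n = nat (l - i - 1)"
    have "nat (l - i) = Suc n" "nat (l - 1 - i) = n"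
      using 3 by (auto simp: n_def)
    with 3 show ?thesis by (simp add: one_minus_fls_X_times_nth binomial_fls_nth)
  qed (auto simp: one_minus_fls_X_times_nth binomial_fls_nth)
qed

text \<open>This justifies reading \<open>binomial_fls i p\<close> as t^i/(1-t)^(p+1). For
  \<open>p = 0\<close> it is the geometric series.\<close>

lemma one_minus_fls_X_power_times_binomial_fls:
  "(1 - fls_X) ^ Suc p * binomial_fls i p = fls_X_intpow i"
proof (induction p)
  case 0
  show ?case
    by (rule fls_eqI) (auto simp: one_minus_fls_X_times_nth binomial_fls_nth)
next
  case (Suc p)
  have "(1 - fls_X) ^ Suc (Suc p) * binomial_fls i (Suc p)
    = (1 - fls_X) ^ Suc p * ((1 - fls_X) * binomial_fls i (Suc p))"
    by (simp add: mult_ac)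
  then show ?case using Suc by (simp only: one_minus_fls_X_times_binomial_fls)
qed

text \<open>The binomial coefficient (x-i+p choose p) as a polynomial in x, factored over its roots
  i-p, ..., i-1 so that the degree can be read off.\<close>

definition binomial_poly :: "int \<Rightarrow> nat \<Rightarrow> complex poly" where
  "binomial_poly i p = smult (1 / fact p) (\<Prod>m<p. [:of_int (int m + 1 - i), 1:])"

lemma degree_binomial_poly: "degree (binomial_poly i p) = p"
  by (simp add: binomial_poly_def degree_prod_eq_sum_degree)

lemma poly_binomial_poly: "poly (binomial_poly i p) x = (x - of_int i + of_nat p) gchoose p"
  by (simp add: binomial_poly_def poly_prod gbinomial_pochhammer' pochhammer_prod
      atLeast0LessThan algebra_simps)

text \<open>Upper negation of the binomial coefficient. It shows both the roots, where the new upper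
  entry is less than \<open>p\<close>, and the sign below them.\<close>

lemma poly_binomial_poly_less:
  assumes "l < i"
  shows "poly (binomial_poly i p) (of_int l) = (-1) ^ p * of_nat (nat (i - l - 1) choose p)"
proof -
  have "of_nat p - (of_int l - of_int i + of_nat p) - 1 = (of_nat (nat (i - l - 1)) :: complex)"
    using assms by (simp add: of_nat_nat)
  then show ?thesis
    unfolding poly_binomial_poly by (subst gbinomial_negated_upper) (simp only: binomial_gbinomial)
qed

lemma poly_binomial_poly_ge:
  assumes "l \<ge> i"
  shows "poly (binomial_poly i p) (of_int l) = binomial_fls i p $$ l"
proof -
  have "of_int l - of_int i + of_nat p = (of_nat (nat (l - i) + p) :: complex)"
    using assms by (simp add: of_nat_nat)
  then show ?thesis
    unfolding poly_binomial_poly using assms by (simp only: binomial_gbinomial binomial_fls_nth if_True)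
qed

lemma poly_binomial_poly_eq_0:
  assumes "i - int p \<le> l" "l < i"
  shows "poly (binomial_poly i p) (of_int l) = 0"
  using assms by (simp add: poly_binomial_poly_less binomial_eq_0)

text \<open>The \<open>p\<close> roots lie directly below the support of the series, so the
  agreement extends \<open>p\<close> indices further down.\<close>

lemma binomial_fls_nth_eq_poly:
  assumes "l \<ge> i - int p"
  shows "binomial_fls i p $$ l = poly (binomial_poly i p) (of_int l)"
  using assms poly_binomial_poly_ge[of i l p] poly_binomial_poly_eq_0[of i p l]
  by (cases "l \<ge> i") (auto simp: binomial_fls_nth)

lemma degree_binomial_poly_mult:
  "degree (binomial_poly i p * binomial_poly j q) < p + q + 1"
  using degree_mult_le[of "binomial_poly i p" "binomial_poly j q"] by (simp add: degree_binomial_poly)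

section \<open>Segre products of two such series\<close>

text \<open>From the larger of i-p and j-q on, both factors agree with their polynomials; adding p+q
  turns this index into the stated bound.\<close>

lemma segre_binomial_fls_vanishing:
  assumes "k > max (int p + j) (int q + i)"
  shows "((1 - fls_X) ^ (p + q + 1) * segre (binomial_fls i p) (binomial_fls j q)) $$ k = 0"
  by (rule one_minus_fls_X_power_times_nth(1)
        [where e = "max (i - int p) (j - int q)" and P = "binomial_poly i p * binomial_poly j q"])
     (use assms degree_binomial_poly_mult in \<open>auto simp: binomial_fls_nth_eq_poly\<close>)

text \<open>The assumptions say j-q \<le> i and i-p \<le> j. So an index below the larger of i-p and
  j-q lies below both \<open>i\<close> and \<open>j\<close>, hence among the roots of at least one
  factor, and both sides are zero.\<close>

lemma segre_binomial_fls_nth_eq_poly: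
  assumes "int q + i - j \<ge> 0" "int p + j - i \<ge> 0" and "l \<ge> min (i - int p) (j - int q)"
  shows "segre (binomial_fls i p) (binomial_fls j q) $$ l
    = poly (binomial_poly i p * binomial_poly j q) (of_int l)"
proof (cases "l \<ge> max (i - int p) (j - int q)")
  case True
  then show ?thesis by (simp add: binomial_fls_nth_eq_poly)
next
  case False
  have "l < i" "l < j" using False assms by auto
  moreover have "l \<ge> i - int p \<or> l \<ge> j - int q" using assms by auto
  ultimately show ?thesis
    using poly_binomial_poly_eq_0[of i p l] poly_binomial_poly_eq_0[of j q l]
    by (auto simp: binomial_fls_nth)
qed

lemma segre_binomial_fls_vanishing_min:
  assumes "int q + i - j \<ge> 0" "int p + j - i \<ge> 0" and "k > min (int p + j) (int q + i)"
  shows "((1 - fls_X) ^ (p + q + 1) * segre (binomial_fls i p) (binomial_fls j q)) $$ k = 0"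
  by (rule one_minus_fls_X_power_times_nth(1)
        [where e = "min (i - int p) (j - int q)" and P = "binomial_poly i p * binomial_poly j q"])
     (use assms degree_binomial_poly_mult segre_binomial_fls_nth_eq_poly in auto)

text \<open>Giving the coefficient as a positive natural number records that it is real, nonzero and
  of the right sign.\<close>

lemma segre_binomial_fls_top:
  assumes "int q + i - j \<ge> 0" "int p + j - i \<ge> 0"
  shows "\<exists>m>0. ((1 - fls_X) ^ (p + q + 1) * segre (binomial_fls i p) (binomial_fls j q))
    $$ min (int p + j) (int q + i) = of_nat m"
proof -
  define e where "e = min (i - int p) (j - int q)"
  \<comment> \<open>Up to sign, the two polynomials take these values at \<open>e - 1\<close>, by
    upper negation.\<close>
  define m where "m = (nat (i - e) choose p) * (nat (j - e) choose q)"
  have top: "((1 - fls_X) ^ (p + q + 1) * segre (binomial_fls i p) (binomial_fls j q))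
      $$ (e + int (p + q + 1) - 1)
    = (-1) ^ (p + q + 1) * (segre (binomial_fls i p) (binomial_fls j q) $$ (e - 1)
        - poly (binomial_poly i p * binomial_poly j q) (of_int (e - 1)))"
    by (rule one_minus_fls_X_power_times_nth(2))
       (use assms degree_binomial_poly_mult segre_binomial_fls_nth_eq_poly in \<open>auto simp: e_def\<close>)
  have "e - 1 < i" "e - 1 < j" unfolding e_def by auto
  then have val: "segre (binomial_fls i p) (binomial_fls j q) $$ (e - 1) = 0"
    "poly (binomial_poly i p * binomial_poly j q) (of_int (e - 1)) = (-1) ^ (p + q) * of_nat m"
    by (simp_all only: poly_mult poly_binomial_poly_less segre_nth binomial_fls_nth m_def)
       (simp_all add: power_add)
  have "e + int (p + q + 1) - 1 = min (int p + j) (int q + i)"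
    unfolding e_def by auto
  then have "((1 - fls_X) ^ (p + q + 1) * segre (binomial_fls i p) (binomial_fls j q))
      $$ min (int p + j) (int q + i) = (-1) ^ (p + q + 1) * (0 - (-1) ^ (p + q) * of_nat m)"
    using top unfolding val by simp
  also have "\<dots> = of_nat m"
    by (simp flip: mult.assoc power_mult_distrib)
  finally have "((1 - fls_X) ^ (p + q + 1) * segre (binomial_fls i p) (binomial_fls j q))
      $$ min (int p + j) (int q + i) = of_nat m" .
  \<comment> \<open>The choice of \<open>e\<close> gives p \<le> i-e and q \<le> j-e, so neither
    binomial coefficient vanishes.\<close>
  moreover have "m > 0"
    unfolding m_def e_def by (auto simp: le_nat_iff)
  ultimately show ?thesis by blast
qed

section \<open>Expansion along the coefficients of the numerators\<close>

lemma laurent_polynomial_eq_sum: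
  assumes "laurent_polynomial h"
  shows "h = (\<Sum>i | h $$ i \<noteq> 0. fls_const (h $$ i) * fls_X_intpow i)"
proof (rule fls_eqI)
  fix n
  have "finite {i. h $$ i \<noteq> 0}" using assms by (simp add: laurent_polynomial_def)
  then show "h $$ n = (\<Sum>i | h $$ i \<noteq> 0. fls_const (h $$ i) * fls_X_intpow i) $$ n"
    by (simp add: fls_nth_sum if_distrib cong: if_cong)
qed

text \<open>Both sides become the numerator after multiplication by (1-t)^(p+1), which can be
  cancelled.\<close>

lemma eq_sum_binomial_fls:
  assumes "property_star a" "b_num a = int p"
  shows "a = (\<Sum>i | h_num a $$ i \<noteq> 0. fls_const (h_num a $$ i) * binomial_fls i p)" (is "a = ?s")
proof -
  have d: "d_exp a = Suc p" using assms(2) by (simp add: b_num_def)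
  have "(1 - fls_X) ^ Suc p * a = h_num a" by (simp only: h_num_def d)
  also have "\<dots> = (\<Sum>i | h_num a $$ i \<noteq> 0. fls_const (h_num a $$ i) * fls_X_intpow i)"
    by (rule laurent_polynomial_eq_sum[OF laurent_polynomial_h_num[OF assms(1)]])
  also have "\<dots> = (1 - fls_X) ^ Suc p * ?s"
    unfolding sum_distrib_left one_minus_fls_X_power_times_binomial_fls[of p, symmetric]
    by (simp add: mult_ac)
  finally show ?thesis
    using one_minus_fls_X_neq_0 by simp
qed

text \<open>Bilinearity of the Segre product reduces everything to pairs of exponents; the power
  p+q+1 is the pole order \<open>d_exp\<close> of the product.\<close>

lemma h_num_segre_nth:
  assumes "property_star a" "b_num a = int p" "property_star b" "b_num b = int q"
  shows "h_num (segre a b) $$ k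
    = (\<Sum>(i, j)\<in>{i. h_num a $$ i \<noteq> 0} \<times> {j. h_num b $$ j \<noteq> 0}. h_num a $$ i * h_num b $$ j *
        ((1 - fls_X) ^ (p + q + 1) * segre (binomial_fls i p) (binomial_fls j q)) $$ k)"
proof -
  let ?S = "{i. h_num a $$ i \<noteq> 0}" and ?T = "{j. h_num b $$ j \<noteq> 0}"
  have d: "d_exp (segre a b) = p + q + 1"
    using b_num_segre[OF assms(1,3)] assms by (simp add: b_num_def)
  have a: "a $$ l = (\<Sum>i\<in>?S. h_num a $$ i * binomial_fls i p $$ l)" for l
    by (subst eq_sum_binomial_fls[OF assms(1,2)]) (simp add: fls_nth_sum)
  have b: "b $$ l = (\<Sum>j\<in>?T. h_num b $$ j * binomial_fls j q $$ l)" for l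
    by (subst eq_sum_binomial_fls[OF assms(3,4)]) (simp add: fls_nth_sum)
  have "segre a b = (\<Sum>(i, j)\<in>?S \<times> ?T. fls_const (h_num a $$ i * h_num b $$ j) *
      segre (binomial_fls i p) (binomial_fls j q))"
    by (rule fls_eqI)
       (simp add: a b fls_nth_sum sum_product sum.cartesian_product case_prod_unfold mult_ac
         del: fls_const_mult_const)
  then have "h_num (segre a b) = (\<Sum>(i, j)\<in>?S \<times> ?T. fls_const (h_num a $$ i * h_num b $$ j) *
      ((1 - fls_X) ^ (p + q + 1) * segre (binomial_fls i p) (binomial_fls j q)))"
    unfolding h_num_def d
    by (simp only: sum_distrib_left case_prod_unfold mult.left_commute)
  then show ?thesis
    by (simp add: fls_nth_sum case_prod_unfold del: fls_const_mult_const)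
qed

section \<open>Extremal exponents of a numerator\<close>

lemma r_num_le:
  assumes "property_star c" "c \<noteq> 0" and "\<And>k. k > K \<Longrightarrow> h_num c $$ k = 0"
  shows "r_num c \<le> K"
proof -
  have "finite {n. h_num c $$ n \<noteq> 0}"
    using laurent_polynomial_h_num[OF assms(1)] by (simp add: laurent_polynomial_def)
  moreover have "{n. h_num c $$ n \<noteq> 0} \<noteq> {}"
    using assms(2) h_num_eq_0_iff[of c] by (auto simp: fls_eq_iff)
  ultimately show ?thesis
    unfolding r_num_def using assms(3) by (subst Max_le_iff) (auto simp: not_less[symmetric])
qed

lemma le_r_num:
  assumes "property_star c" "h_num c $$ k \<noteq> 0"
  shows "k \<le> r_num c"
  unfolding r_num_def using assms laurent_polynomial_h_num[OF assms(1)]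
  by (intro Max_ge) (auto simp: laurent_polynomial_def)

lemma sigma_num_le:
  assumes "property_star c" "h_num c $$ k \<noteq> 0"
  shows "sigma_num c \<le> k"
  unfolding sigma_num_def using assms laurent_polynomial_h_num[OF assms(1)]
  by (intro Min_le) (auto simp: laurent_polynomial_def)

lemma h_num_r_num_neq_0:
  assumes "property_star c" "c \<noteq> 0"
  shows "h_num c $$ r_num c \<noteq> 0"
proof
  assume z: "h_num c $$ r_num c = 0"
  \<comment> \<open>If the coefficient vanished, \<open>r_num c - 1\<close> would already bound the
    support.\<close>
  have "r_num c \<le> r_num c - 1"
  proof (rule r_num_le[OF assms])
    fix k assume "k > r_num c - 1"
    then show "h_num c $$ k = 0"
      using le_r_num[OF assms(1), of k] z by (cases "k = r_num c") auto
  qed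
  then show False by simp
qed

text \<open>The zero series has \<open>b_num\<close> equal to -1, whereas the product has a
  nonnegative one. This makes the maximum in \<open>r_num\<close> range over a nonempty set.\<close>

lemma segre_neq_0:
  assumes "property_star a" "b_num a \<ge> 0" "property_star b" "b_num b \<ge> 0"
  shows "segre a b \<noteq> 0"
proof
  assume "segre a b = 0"
  moreover have "Phi_poly 0 = 0" by (rule Phi_poly_eqI) simp
  ultimately show False
    using b_num_segre[OF assms(1,3,2,4)] assms(2,4) by (simp add: b_num_def d_exp_def)
qed

section \<open>The degree bounds and the case of equality\<close>

text \<open>Every pair of exponents contributes zero beyond its own bound, which is monotone in
  \<open>i\<close> and \<open>j\<close> and so largest at the two top exponents.\<close>

lemma r_num_segre_le_max:
  assumes "property_star a" "b_num a \<ge> 0" "property_star b" "b_num b \<ge> 0"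
  shows "r_num (segre a b) \<le> max (b_num a + r_num b) (b_num b + r_num a)"
proof (rule r_num_le)
  fix k assume k: "k > max (b_num a + r_num b) (b_num b + r_num a)"
  obtain p q where pq: "b_num a = int p" "b_num b = int q"
    using assms(2,4) by (metis nonneg_int_cases)
  show "h_num (segre a b) $$ k = 0"
    unfolding h_num_segre_nth[OF assms(1) pq(1) assms(3) pq(2)]
  proof (intro sum.neutral ballI, clarify)
    fix i j assume "h_num a $$ i \<noteq> 0" "h_num b $$ j \<noteq> 0"
    then have "i \<le> r_num a" "j \<le> r_num b"
      using le_r_num assms by auto
    then have "k > max (int p + j) (int q + i)"
      using k pq by auto
    then show "h_num a $$ i * h_num b $$ j *
        ((1 - fls_X) ^ (p + q + 1) * segre (binomial_fls i p) (binomial_fls j q)) $$ k = 0"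
      by (simp only: segre_binomial_fls_vanishing mult_zero_right)
  qed
qed (use assms property_star_segre segre_neq_0 in auto)

lemma r_num_segre_le_min:
  assumes "property_star a" "b_num a \<ge> 0" "property_star b" "b_num b \<ge> 0"
    and gap: "\<And>i j. h_num a $$ i \<noteq> 0 \<Longrightarrow> h_num b $$ j \<noteq> 0
      \<Longrightarrow> b_num b + i - j \<ge> 0 \<and> b_num a + j - i \<ge> 0"
  shows "r_num (segre a b) \<le> min (b_num a + r_num b) (b_num b + r_num a)"
proof (rule r_num_le)
  fix k assume k: "k > min (b_num a + r_num b) (b_num b + r_num a)"
  obtain p q where pq: "b_num a = int p" "b_num b = int q"
    using assms(2,4) by (metis nonneg_int_cases)
  show "h_num (segre a b) $$ k = 0"
    unfolding h_num_segre_nth[OF assms(1) pq(1) assms(3) pq(2)]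
  proof (intro sum.neutral ballI, clarify)
    fix i j assume ij: "h_num a $$ i \<noteq> 0" "h_num b $$ j \<noteq> 0"
    then have "i \<le> r_num a" "j \<le> r_num b"
      using le_r_num assms by auto
    then have "k > min (int p + j) (int q + i)"
      using k pq by auto
    then show "h_num a $$ i * h_num b $$ j *
        ((1 - fls_X) ^ (p + q + 1) * segre (binomial_fls i p) (binomial_fls j q)) $$ k = 0"
      using gap[OF ij] pq by (simp only: segre_binomial_fls_vanishing_min mult_zero_right)
  qed
qed (use assms property_star_segre segre_neq_0 in auto)

text \<open>At the index \<open>?K\<close> no contribution is negative, and the pair of top
  exponents contributes a positive amount, so nothing cancels.\<close>

lemma r_num_segre_eq_min:
  assumes "property_star a" "a \<noteq> 0" "b_num a \<ge> 0" "property_star b" "b \<noteq> 0" "b_num b \<ge> 0"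
    and gap: "\<And>i j. h_num a $$ i \<noteq> 0 \<Longrightarrow> h_num b $$ j \<noteq> 0
      \<Longrightarrow> b_num b + i - j \<ge> 0 \<and> b_num a + j - i \<ge> 0"
    and nonneg: "\<And>i. h_num a $$ i \<in> \<real>\<^sub>\<ge>\<^sub>0" "\<And>j. h_num b $$ j \<in> \<real>\<^sub>\<ge>\<^sub>0"
  shows "r_num (segre a b) = min (b_num a + r_num b) (b_num b + r_num a)" (is "_ = ?K")
proof (rule antisym)
  show "r_num (segre a b) \<le> ?K"
    using assms by (intro r_num_segre_le_min)
next
  obtain p q where pq: "b_num a = int p" "b_num b = int q"
    using assms(3,6) by (metis nonneg_int_cases)
  let ?S = "{i. h_num a $$ i \<noteq> 0}" and ?T = "{j. h_num b $$ j \<noteq> 0}"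
  define f where "f = (\<lambda>(i, j). h_num a $$ i * h_num b $$ j *
    ((1 - fls_X) ^ (p + q + 1) * segre (binomial_fls i p) (binomial_fls j q)) $$ ?K)"
  \<comment> \<open>Real parts make the order on the reals available for the sum.\<close>
  have f_pos: "Re (f (i, j)) > 0"
    if ij: "i \<in> ?S" "j \<in> ?T" and K: "?K = min (int p + j) (int q + i)" for i j
  proof -
    obtain x where x: "h_num a $$ i = of_real x" "x \<ge> 0"
      using nonneg(1) by (rule nonneg_Reals_cases)
    obtain y where y: "h_num b $$ j = of_real y" "y \<ge> 0"
      using nonneg(2) by (rule nonneg_Reals_cases)
    obtain m :: nat where m: "m > 0"
      "((1 - fls_X) ^ (p + q + 1) * segre (binomial_fls i p) (binomial_fls j q)) $$ ?K = of_nat m"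
      unfolding K using segre_binomial_fls_top[of q i j p] gap[of i j] ij pq by auto
    have "f (i, j) = of_real (x * y * real m)"
      by (simp only: f_def prod.case m x y of_real_mult of_real_of_nat_eq)
    moreover have "x > 0" "y > 0" using x y ij by (auto simp: less_le)
    ultimately show ?thesis using m(1) by simp
  qed
  have f_nonneg: "Re (f (i, j)) \<ge> 0" if ij: "i \<in> ?S" "j \<in> ?T" for i j
  proof (cases "?K = min (int p + j) (int q + i)")
    case True
    then show ?thesis using f_pos[OF ij] by simp
  next
    \<comment> \<open>By monotonicity the pair's own bound is then strictly below \<open>?K\<close>,
      where its contribution vanishes.\<close>
    case False
    have "i \<le> r_num a" "j \<le> r_num b" using ij le_r_num assms by auto
    with False have "?K > min (int p + j) (int q + i)" unfolding pq by auto
    moreover have "int q + i - j \<ge> 0" "int p + j - i \<ge> 0"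
      using gap[of i j] ij pq by auto
    ultimately have "f (i, j) = 0"
      by (simp only: f_def prod.case segre_binomial_fls_vanishing_min mult_zero_right)
    then show ?thesis by simp
  qed
  have fin: "finite (?S \<times> ?T)"
    using laurent_polynomial_h_num assms by (auto simp: laurent_polynomial_def)
  have r: "(r_num a, r_num b) \<in> ?S \<times> ?T"
    using h_num_r_num_neq_0 assms by auto
  have "h_num (segre a b) $$ ?K = sum f (?S \<times> ?T)"
    unfolding h_num_segre_nth[OF assms(1) pq(1) assms(4) pq(2)] f_def by simp
  moreover have "(\<Sum>x\<in>?S \<times> ?T. Re (f x)) > 0"
    by (rule sum_pos2[OF fin r]) (use f_pos r f_nonneg pq in auto)
  then have "sum f (?S \<times> ?T) \<noteq> 0"
    by (metis Re_sum less_irrefl zero_complex.sel(1))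
  ultimately show "?K \<le> r_num (segre a b)"
    using le_r_num property_star_segre assms by metis
qed

theorem proposition3p3:
  fixes a b :: "complex fls"
  assumes "a \<noteq> 0" and "property_star a" and "b_num a \<ge> 0"
    and "b \<noteq> 0" and "property_star b" and "b_num b \<ge> 0"
  shows
    "r_num (segre a b) \<le> max (b_num a + r_num b) (b_num b + r_num a)
     \<and>
     ((\<forall>i j. sigma_num a \<le> i \<and> i \<le> r_num a \<and> sigma_num b \<le> j \<and> j \<le> r_num b
           \<and> h_num a $$ i \<noteq> 0 \<and> h_num b $$ j \<noteq> 0
           \<longrightarrow> b_num b + i - j \<ge> 0 \<and> b_num a + j - i \<ge> 0)
      \<longrightarrow> r_num (segre a b) \<le> min (b_num a + r_num b) (b_num b + r_num a)
        \<and> ((\<forall>i. h_num a $$ i \<in> \<real>\<^sub>\<ge>\<^sub>0) \<and> (\<forall>j. h_num b $$ j \<in> \<real>\<^sub>\<ge>\<^sub>0)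
           \<longrightarrow> r_num (segre a b) = min (b_num a + r_num b) (b_num b + r_num a)))
     \<and>
     (0 \<le> sigma_num a \<and> sigma_num a \<le> r_num a \<and> r_num a \<le> b_num a
      \<and> 0 \<le> sigma_num b \<and> sigma_num b \<le> r_num b \<and> r_num b \<le> b_num b
      \<longrightarrow> r_num (segre a b) \<le> min (b_num a + r_num b) (b_num b + r_num a)
        \<and> ((\<forall>i. h_num a $$ i \<in> \<real>\<^sub>\<ge>\<^sub>0) \<and> (\<forall>j. h_num b $$ j \<in> \<real>\<^sub>\<ge>\<^sub>0)
           \<longrightarrow> r_num (segre a b) = min (b_num a + r_num b) (b_num b + r_num a)))"
proof (intro conjI impI)
  note max_bound = r_num_segre_le_max[OF assms(2,3,5,6)]
    and min_bound = r_num_segre_le_min[OF assms(2,3,5,6)]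
    and min_eq = r_num_segre_eq_min[OF assms(2,1,3,5,4,6)]
  note range_a = sigma_num_le[OF assms(2)] le_r_num[OF assms(2)]
    and range_b = sigma_num_le[OF assms(5)] le_r_num[OF assms(5)]
  let ?min = "min (b_num a + r_num b) (b_num b + r_num a)"
  show "r_num (segre a b) \<le> max (b_num a + r_num b) (b_num b + r_num a)"
    by (rule max_bound)
  {
    assume "\<forall>i j. sigma_num a \<le> i \<and> i \<le> r_num a \<and> sigma_num b \<le> j \<and> j \<le> r_num b
           \<and> h_num a $$ i \<noteq> 0 \<and> h_num b $$ j \<noteq> 0
           \<longrightarrow> b_num b + i - j \<ge> 0 \<and> b_num a + j - i \<ge> 0"
    \<comment> \<open>Nonzero coefficients satisfy the range conditions automatically.\<close>
    then have gap: "b_num b + i - j \<ge> 0 \<and> b_num a + j - i \<ge> 0"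
      if "h_num a $$ i \<noteq> 0" "h_num b $$ j \<noteq> 0" for i j
      using that range_a range_b by blast
    show "r_num (segre a b) \<le> ?min"
      by (rule min_bound) (fact gap)
    assume "(\<forall>i. h_num a $$ i \<in> \<real>\<^sub>\<ge>\<^sub>0) \<and> (\<forall>j. h_num b $$ j \<in> \<real>\<^sub>\<ge>\<^sub>0)"
    then show "r_num (segre a b) = ?min"
      by (intro min_eq) (use gap in blast)+
  }
  {
    assume bounds: "0 \<le> sigma_num a \<and> sigma_num a \<le> r_num a \<and> r_num a \<le> b_num a
      \<and> 0 \<le> sigma_num b \<and> sigma_num b \<le> r_num b \<and> r_num b \<le> b_num b"
    \<comment> \<open>Part (3) is a case of part (2): all exponents \<open>i\<close> and
      \<open>j\<close> are nonnegative, with \<open>i\<close> at most \<open>b_num a\<close> and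
      \<open>j\<close> at most \<open>b_num b\<close>.\<close>
    have gap: "b_num b + i - j \<ge> 0 \<and> b_num a + j - i \<ge> 0"
      if "h_num a $$ i \<noteq> 0" "h_num b $$ j \<noteq> 0" for i j
      using bounds range_a[OF that(1)] range_b[OF that(2)] by linarith
    show "r_num (segre a b) \<le> ?min"
      by (rule min_bound) (fact gap)
    assume "(\<forall>i. h_num a $$ i \<in> \<real>\<^sub>\<ge>\<^sub>0) \<and> (\<forall>j. h_num b $$ j \<in> \<real>\<^sub>\<ge>\<^sub>0)"
    then show "r_num (segre a b) = ?min"
      by (intro min_eq) (use gap in blast)+
  }
qed

end
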